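(* Let $N\ge 2$ be an integer and let $x_1\le x_2\le\cdots\le x_N$ be real numbers with $x_1<x_N$. Let $X_1,X_2$ be independent random variables, each uniformly distributed on $\mathcal{P}=\{x_1,\ldots,x_N\}$ (counted with multiplicity). Let $X_{1:2}=\min\{X_1,X_2\}$, $X_{2:2}=\max\{X_1,X_2\}$, and $$\rho_{12}=\frac{\operatorname{Cov}(X_{1:2},X_{2:2})}{\sqrt{\operatorname{Var} X_{1:2}}\,\sqrt{\operatorname{Var} X_{2:2}}}.$$ Then $$\rho_{12}\le \frac{1-N^{-2}}{2+N^{-2}},$$ and equality holds if and only if there is a constant $\lambda>0$ such that $x_{i+1}-x_i=\lambda$ for all $i=1,\ldots,N-1$.
   Context: Uniform distribution on $\mathcal{P}=\{x_1,\ldots,x_N\}$ in the possible presence of ties: if the distinct values among $x_1,\ldots,x_N$ are $y_1<\cdots<y_m$ and exactly $k_j$ of the $x_i$'s equal $y_j$ (so $k_1+\cdots+k_m=N$), then $X$ is uniform on $\mathcal{P}$ if $\Pr(X=y_j)=k_j/N$ for $j=1,\ldots,m$. *)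

theory Defs
  imports "HOL-Probability.Probability"
begin

text \<open>
  Uniform distribution on a finite family of reals counted with multiplicity: each distinct
  value is taken with probability proportional to its number of occurrences in the family.
\<close>

definition uniform_on_family ::
    "'a measure \<Rightarrow> ('a \<Rightarrow> real) \<Rightarrow> nat \<Rightarrow> (nat \<Rightarrow> real) \<Rightarrow> bool" where
  "uniform_on_family M X N x \<longleftrightarrow>
     X \<in> borel_measurable M \<and>
     (\<forall>y \<in> x ` {1..N}.
        measure M {\<omega> \<in> space M. X \<omega> = y} = real (card {i \<in> {1..N}. x i = y}) / real N)"

definition covariance :: "'a measure \<Rightarrow> ('a \<Rightarrow> real) \<Rightarrow> ('a \<Rightarrow> real) \<Rightarrow> real" where
  "covariance M X Y =
     prob_space.expectation M
       (\<lambda>\<omega>. (X \<omega> - prob_space.expectation M X) * (Y \<omega> - prob_space.expectation M Y))"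

definition correlation :: "'a measure \<Rightarrow> ('a \<Rightarrow> real) \<Rightarrow> ('a \<Rightarrow> real) \<Rightarrow> real" where
  "correlation M X Y =
     covariance M X Y / (sqrt (prob_space.variance M X) * sqrt (prob_space.variance M Y))"

end

theory Submission
  imports Defs
begin

text \<open>
  Write \<open>u k = 2 k - 1 - N\<close> and let \<open>z\<close> be the family \<open>x\<close> minus its mean. The covariance of
  minimum and maximum is \<open>a\<^sup>2\<close> with \<open>N\<^sup>2 a = \<Sum> u z\<close>, and the two variances are
  \<open>\<Sum> z\<^sup>2 / N - a\<^sup>2 \<mp> T / N\<^sup>2\<close> with \<open>T = \<Sum> u z\<^sup>2\<close>. So everything reduces to an upper bound for \<open>T\<^sup>2\<close>
  in terms of \<open>W = (\<Sum> u z)\<^sup>2 / \<Sum> u\<^sup>2\<close> and the squared distance \<open>R = \<Sum> z\<^sup>2 - W\<close> of \<open>z\<close> from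
  the multiples of \<open>u\<close>. Expand \<open>z\<close> in the discrete Legendre (Gram) polynomials, which are
  orthogonal on the points \<open>u k\<close>: multiplication by \<open>u\<close> becomes a tridiagonal matrix, \<open>T\<close> is a sum
  over neighbouring coefficients, and a single Cauchy-Schwarz inequality gives
  \<open>T\<^sup>2 \<le> N\<^sup>2 (4/3 W R + R\<^sup>2)\<close>. This loses a positive multiple of \<open>W R\<close>, so equality
  forces \<open>R = 0\<close>, i.e. equally spaced values.
\<close>

subsection \<open>Discrete Legendre polynomials\<close>

text \<open>The nodes have mean 0 and spacing 2. Also \<open>N + centred N k\<close> and
  \<open>N - centred N k\<close> are the weights of the \<open>k\<close>-th sorted value in the laws
  of the maximum and the minimum, counted in ordered pairs out of \<open>N^2\<close>.\<close>

definition centred :: "nat \<Rightarrow> nat \<Rightarrow> real" where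
  "centred N k = 2 * real k - 1 - real N"

text \<open>Recurrence coefficients of the monic discrete Legendre polynomials on nodes of spacing
  2. They are positive for \<open>0 < n < N\<close> and vanish at \<open>n = 0\<close> and
  \<open>n = N\<close>.\<close>

definition gram_coeff :: "nat \<Rightarrow> nat \<Rightarrow> real" where
  "gram_coeff N n = real n ^ 2 * (real N ^ 2 - real n ^ 2) / (4 * real n ^ 2 - 1)"

fun gram :: "nat \<Rightarrow> nat \<Rightarrow> real \<Rightarrow> real" where
  "gram N 0 u = 1"
| "gram N (Suc 0) u = u"
| "gram N (Suc (Suc n)) u = u * gram N (Suc n) u - gram_coeff N (Suc n) * gram N n u"

lemma gram_coeff_0 [simp]: "gram_coeff N 0 = 0"
  by (simp add: gram_coeff_def)

text \<open>Holds uniformly in \<open>n\<close>: at \<open>n = 0\<close> the truncated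
  \<open>n - 1\<close> is harmless because its coefficient is 0.\<close>

lemma gram_times: "u * gram N n u = gram N (Suc n) u + gram_coeff N n * gram N (n - 1) u"
  by (cases n) auto

text \<open>Since \<open>4 n^2 - 1\<close> factors, both products have denominator
  \<open>2 n + 1\<close>, which also divides the difference of the numerators. In this form the
  coefficients enter the induction for the difference equations.\<close>

lemma gram_coeff_step:
  "(2 * real n + 3) * gram_coeff N (Suc n)
     = (2 * real n - 1) * gram_coeff N n + real N ^ 2 - 2 * real n ^ 2 - 2 * real n - 1"
proof -
  have a: "4 * real (Suc n) ^ 2 - 1 = (2 * real n + 1) * (2 * real n + 3)"
    by (simp add: power2_eq_square algebra_simps)
  have b: "4 * real n ^ 2 - 1 = (2 * real n + 1) * (2 * real n - 1)"
    by (simp add: power2_eq_square algebra_simps)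
  \<comment> \<open>The first factor is nonzero by parity, which covers \<open>n = 0\<close>, where
    it is negative.\<close>
  have nz: "2 * real n - 1 \<noteq> 0" "2 * real n + 3 \<noteq> 0" "2 * real n + 1 \<noteq> 0"
    by (auto simp: add_nonneg_eq_0_iff) (metis of_nat_1 of_nat_eq_iff of_nat_mult of_nat_numeral
        dvd_triv_left odd_one)
  have cancel: "w * (p / w - q / w) = p - q" if "w \<noteq> 0" for p q w :: real
    using that by (simp add: right_diff_distrib)
  have "(2 * real n + 3) * gram_coeff N (Suc n)
      = real (Suc n) ^ 2 * (real N ^ 2 - real (Suc n) ^ 2) / (2 * real n + 1)"
    unfolding gram_coeff_def a using nz by simp
  moreover have "(2 * real n - 1) * gram_coeff N n
      = real n ^ 2 * (real N ^ 2 - real n ^ 2) / (2 * real n + 1)"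
    unfolding gram_coeff_def b using nz by simp
  ultimately have "(2 * real n + 1) * ((2 * real n + 3) * gram_coeff N (Suc n)
      - (2 * real n - 1) * gram_coeff N n)
      = real (Suc n) ^ 2 * (real N ^ 2 - real (Suc n) ^ 2) - real n ^ 2 * (real N ^ 2 - real n ^ 2)"
    using cancel[OF nz(3)] by presburger
  also have "\<dots> = (2 * real n + 1) * (real N ^ 2 - 2 * real n ^ 2 - 2 * real n - 1)"
    by (simp add: algebra_simps power2_eq_square)
  finally show ?thesis
    using nz(3) by simp
qed

text \<open>
  The first identity says that \<open>gram N n\<close> is an eigenfunction, with eigenvalue \<open>4 n (n + 1)\<close>, of
  \<open>f \<mapsto> D ((u\<^sup>2 - N\<^sup>2) D f)\<close> where \<open>D f u = f (u + 1) - f (u - 1)\<close>: the discrete Legendre equation.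
  The second one is only needed to make the induction work.
\<close>
lemma gram_difference_equations:
  "((u + 1)^2 - real N ^ 2) * gram N n (u + 2) + ((u - 1)^2 - real N ^ 2) * gram N n (u - 2)
     = (4 * real n * (real n + 1) + 2 * (u^2 + 1 - real N ^ 2)) * gram N n u"
  (is "?P n + ?Q n = ?s n")
  "((u + 1)^2 - real N ^ 2) * gram N n (u + 2) - ((u - 1)^2 - real N ^ 2) * gram N n (u - 2)
     = 4 * (real n + 1) * u * gram N n u
       - 4 * (2 * real n + 1) * gram_coeff N n * gram N (n - 1) u"
  (is "_ = ?d n")
proof -
  \<comment> \<open>The recurrence reaches back two degrees, so the induction carries degrees
    \<open>n\<close> and \<open>n + 1\<close> together.\<close>
  have "?P n + ?Q n = ?s n \<and> ?P n - ?Q n = ?d n \<and>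
        ?P (Suc n) + ?Q (Suc n) = ?s (Suc n) \<and> ?P (Suc n) - ?Q (Suc n) = ?d (Suc n)"
  proof (induction n)
    case 0
    show ?case
      using gram_coeff_step[of 0 N] by (simp add: algebra_simps power2_eq_square)
  next
    case (Suc n)
    let ?b = "gram_coeff N (Suc n)"
    let ?c = "gram_coeff N (Suc (Suc n))"
    define g where "g = gram N n u"
    define g' where "g' = gram N (Suc n) u"
    define b where "b = ?b"
    define c where "c = ?c"
    define r where "r = real n"
    define P where "P = ?P n"
    define Q where "Q = ?Q n"
    define P' where "P' = ?P (Suc n)"
    define Q' where "Q' = ?Q (Suc n)"
    define e where "e = gram_coeff N n * gram N (n - 1) u"
    define K where "K = real N ^ 2"
    have e: "e = u * g - g'"
      using gram_times[of u N n] by (simp add: e_def g_def g'_def)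
    have c: "(2 * r + 5) * c = (2 * r + 1) * b + K - 2 * (r+1)^2 - 2 * (r+1) - 1"
      using gram_coeff_step[of "Suc n" N]
      by (simp add: b_def c_def r_def K_def algebra_simps power2_eq_square)
    have h1: "P + Q = (4 * r * (r + 1) + 2 * (u^2 + 1 - K)) * g"
      using Suc.IH by (simp add: P_def Q_def g_def r_def K_def)
    have h2: "P - Q = 4 * (r + 1) * u * g - 4 * (2 * r + 1) * e"
      using Suc.IH by (simp add: P_def Q_def g_def r_def K_def e_def mult.assoc)
    have h3: "P' + Q' = (4 * (r + 1) * (r + 2) + 2 * (u^2 + 1 - K)) * g'"
      using Suc.IH by (simp add: P'_def Q'_def g'_def r_def K_def algebra_simps del: gram.simps)
    have h4: "P' - Q' = 4 * (r + 2) * u * g' - 4 * (2 * r + 3) * (b * g)"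
      using Suc.IH
      by (simp add: P'_def Q'_def g_def g'_def b_def r_def K_def algebra_simps del: gram.simps)
    have P'': "?P (Suc (Suc n)) = (u + 2) * P' - b * P"
      by (simp add: P'_def P_def b_def algebra_simps)
    have Q'': "?Q (Suc (Suc n)) = (u - 2) * Q' - b * Q"
      by (simp add: Q'_def Q_def b_def algebra_simps)
    have g'': "gram N (Suc (Suc n)) u = u * g' - b * g"
      by (simp add: g'_def g_def b_def)
    \<comment> \<open>Shifting the argument turns the factor \<open>u\<close> of the recurrence into
      \<open>u + 2\<close> or \<open>u - 2\<close>. The extra 2 mixes sums with differences, so
      neither identity can be proved without the other.\<close>
    have "(u + 2) * P' - b * P + ((u - 2) * Q' - b * Q)
        = u * (P' + Q') + 2 * (P' - Q') - b * (P + Q)"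
      by (simp add: algebra_simps)
    also have "\<dots> = (4 * (r+2) * (r + 3) + 2 * (u^2 + 1 - K)) * (u * g' - b * g)"
      unfolding h1 h3 h4 by (simp add: algebra_simps power2_eq_square)
    finally have A: "(u + 2) * P' - b * P + ((u - 2) * Q' - b * Q)
        = (4 * (r+2) * (r + 3) + 2 * (u^2 + 1 - K)) * (u * g' - b * g)" .
    have "(u + 2) * P' - b * P - ((u - 2) * Q' - b * Q)
        = u * (P' - Q') + 2 * (P' + Q') - b * (P - Q)"
      by (simp add: algebra_simps)
    also have "\<dots> = 4 * (r + 3) * u * (u * g' - b * g) - 4 * ((2 * r + 5) * c) * g'"
      unfolding h2 h3 h4 e c by (simp add: algebra_simps power2_eq_square)
    finally have B: "(u + 2) * P' - b * P - ((u - 2) * Q' - b * Q)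
        = 4 * (r + 3) * u * (u * g' - b * g) - 4 * ((2 * r + 5) * c) * g'" .
    show ?case
      using Suc.IH A B unfolding P'' Q'' g''
      by (simp add: r_def K_def c_def g'_def algebra_simps del: gram.simps)
  qed
  then show "?P n + ?Q n = ?s n" "?P n - ?Q n = ?d n" by auto
qed

text \<open>Summing the discrete Legendre equation over the nodes telescopes. The boundary terms
  vanish because \<open>(2 k - N)^2 = N^2\<close> at \<open>k = 0\<close> and \<open>k = N\<close>,
  and the eigenvalue is nonzero for \<open>n > 0\<close>.\<close>

lemma sum_gram_eq_0:
  assumes "n > 0"
  shows "(\<Sum>k=1..N. gram N n (centred N k)) = 0"
proof -
  define F where
    "F = (\<lambda>k. ((2 * real k - real N)^2 - real N ^ 2) *
            (gram N n (2 * real k + 1 - real N) - gram N n (2 * real k - 1 - real N)))"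
  have step: "F (Suc k) - F k = 4 * real n * (real n + 1) * gram N n (centred N (Suc k))" for k
  proof -
    define u where "u = centred N (Suc k)"
    have u: "2 * real k + 1 - real N = u" "2 * real k - 1 - real N = u - 2"
      "2 * real k - real N = u - 1"
      "2 * real (Suc k) + 1 - real N = u + 2" "2 * real (Suc k) - 1 - real N = u"
      "2 * real (Suc k) - real N = u + 1"
      by (auto simp: u_def centred_def)
    show ?thesis
      unfolding F_def u u_def[symmetric] using gram_difference_equations(1)[of u N n]
      by (simp add: algebra_simps power2_eq_square)
  qed
  have "4 * real n * (real n + 1) * (\<Sum>k=1..N. gram N n (centred N k))
      = (\<Sum>k<N. F (Suc k) - F k)"
    by (simp add: step sum_distrib_left sum.atLeast1_atMost_eq)
  also have "\<dots> = F N - F 0"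
    by (rule sum_lessThan_telescope)
  also have "\<dots> = 0"
    by (simp add: F_def)
  finally show ?thesis
    using assms by (auto simp: add_nonneg_eq_0_iff)
qed

section \<open>Orthogonality and norms of the Gram polynomials\<close>

definition gram_inner :: "nat \<Rightarrow> nat \<Rightarrow> nat \<Rightarrow> real" where
  "gram_inner N m n = (\<Sum>k=1..N. gram N m (centred N k) * gram N n (centred N k))"

lemma gram_inner_commute: "gram_inner N m n = gram_inner N n m"
  by (simp add: gram_inner_def mult.commute)

text \<open>Multiplication by \<open>u\<close> is self-adjoint for this inner product; both ways of
  expanding it by \<open>gram_times\<close> are compared.\<close>

lemma gram_inner_Suc:
  "gram_inner N (Suc m) n = gram_inner N m (Suc n) + gram_coeff N n * gram_inner N m (n - 1)
     - gram_coeff N m * gram_inner N (m - 1) n"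
proof -
  have "gram N (Suc m) u * gram N n u = gram N m u * gram N (Suc n) u
      + gram_coeff N n * (gram N m u * gram N (n - 1) u)
      - gram_coeff N m * (gram N (m - 1) u * gram N n u)" for u
    using gram_times[of u N m] gram_times[of u N n] by algebra
  then show ?thesis
    unfolding gram_inner_def by (simp add: sum.distrib sum_subtractf sum_distrib_left)
qed

text \<open>Degree is moved from the left factor to the right until the left one is constant, where
  \<open>sum_gram_eq_0\<close> applies.\<close>

lemma gram_inner_less: "m < n \<Longrightarrow> gram_inner N m n = 0"
proof (induction m arbitrary: n rule: less_induct)
  case (less m)
  show ?case
  proof (cases m)
    case 0
    then show ?thesis
      using less.prems sum_gram_eq_0[of n N] by (simp add: gram_inner_def)
  next
    case (Suc l)
    have "gram_inner N l (Suc n) = 0" "gram_inner N l (n - 1) = 0"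
      using less.prems Suc by (auto intro!: less.IH)
    moreover have "gram_coeff N l * gram_inner N (l - 1) n = 0"
      using less.prems Suc by (cases l) (auto intro!: less.IH)
    ultimately show ?thesis
      by (simp add: Suc gram_inner_Suc)
  qed
qed

lemma gram_inner_neq: "m \<noteq> n \<Longrightarrow> gram_inner N m n = 0"
  by (metis gram_inner_less gram_inner_commute nat_neq_iff)

lemma gram_inner_Suc_Suc:
  "gram_inner N (Suc n) (Suc n) = gram_coeff N (Suc n) * gram_inner N n n"
proof -
  have "gram_coeff N n * gram_inner N (n - 1) (Suc n) = 0"
    by (simp add: gram_inner_less)
  then show ?thesis
    by (simp add: gram_inner_Suc gram_inner_less)
qed

lemma gram_coeff_pos:
  assumes "0 < n" "n < N"
  shows "gram_coeff N n > 0"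
proof -
  have "real n ^ 2 \<ge> 1" using assms by (simp add: one_le_power)
  then have "4 * real n ^ 2 - 1 > 0" by linarith
  moreover have "real n ^ 2 < real N ^ 2"
    using assms by (intro power_strict_mono) auto
  ultimately show ?thesis
    unfolding gram_coeff_def using assms by (intro divide_pos_pos mult_pos_pos) auto
qed

lemma gram_inner_pos: "n < N \<Longrightarrow> gram_inner N n n > 0"
proof (induction n)
  case 0
  then show ?case by (simp add: gram_inner_def)
next
  case (Suc n)
  then show ?case by (simp add: gram_inner_Suc_Suc gram_coeff_pos)
qed

section \<open>Expansion of arbitrary functions on the nodes\<close>

lemma times_gram_combination:
  "\<exists>d'. \<forall>u. u * (\<Sum>n<M. d n * gram N n u) = (\<Sum>n<Suc M. d' n * gram N n u)"
proof (induction M)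
  case 0
  show ?case by (intro exI[of _ "\<lambda>_. 0"]) simp
next
  case (Suc M)
  then obtain d' where d': "\<And>u. u * (\<Sum>n<M. d n * gram N n u) = (\<Sum>n<Suc M. d' n * gram N n u)"
    by blast
  \<comment> \<open>The new term \<open>u * gram N M u\<close> contributes at degrees
    \<open>M + 1\<close> and \<open>M - 1\<close>; for \<open>M = 0\<close> the latter contribution
    is 0.\<close>
  define e where "e = (\<lambda>n. (if n = Suc M then d M else d' n)
      + (if n = M - 1 then d M * gram_coeff N M else 0))"
  have "u * (\<Sum>n<Suc M. d n * gram N n u) = (\<Sum>n<Suc (Suc M). e n * gram N n u)" for u
  proof -
    have "(\<Sum>n<Suc (Suc M). e n * gram N n u)
        = (\<Sum>n<Suc (Suc M). (if n = Suc M then d M else d' n) * gram N n u)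
        + (\<Sum>n<Suc (Suc M). if n = M - 1 then d M * gram_coeff N M * gram N n u else 0)"
      unfolding e_def sum.distrib[symmetric] by (intro sum.cong) (auto simp: algebra_simps)
    also have "\<dots> = d M * gram N (Suc M) u + (\<Sum>n<Suc M. d' n * gram N n u)
        + d M * gram_coeff N M * gram N (M - 1) u"
      by (subst sum.delta) auto
    also have "\<dots> = u * (\<Sum>n<M. d n * gram N n u) + d M * (u * gram N M u)"
      unfolding d' gram_times[of u N M] by (simp add: algebra_simps del: gram.simps)
    also have "\<dots> = u * (\<Sum>n<Suc M. d n * gram N n u)"
      by (simp add: algebra_simps)
    finally show ?thesis by simp
  qed
  then show ?case by blast
qed

lemma prod_gram_combination:
  "\<exists>d. \<forall>u. (\<Prod>j=1..M. u - c j) = (\<Sum>n<Suc M. d n * gram N n u)"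
proof (induction M)
  case 0
  show ?case by (intro exI[of _ "\<lambda>_. 1"]) simp
next
  case (Suc M)
  then obtain d where d: "\<And>u. (\<Prod>j=1..M. u - c j) = (\<Sum>n<Suc M. d n * gram N n u)"
    by blast
  obtain d' where d': "\<And>u. u * (\<Sum>n<Suc M. d n * gram N n u) = (\<Sum>n<Suc (Suc M). d' n * gram N n u)"
    using times_gram_combination[where M = "Suc M" and d = d and N = N] by blast
  define e where "e = (\<lambda>n. d' n - (if n < Suc M then c (Suc M) * d n else 0))"
  have "(\<Prod>j=1..Suc M. u - c j) = (\<Sum>n<Suc (Suc M). e n * gram N n u)" for u
  proof -
    have "(\<Sum>n<Suc (Suc M). e n * gram N n u) = (\<Sum>n<Suc (Suc M). d' n * gram N n u)
        - c (Suc M) * (\<Sum>n<Suc M. d n * gram N n u)"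
      unfolding e_def by (simp add: algebra_simps sum_subtractf sum_distrib_left)
    then show ?thesis
      unfolding d'[symmetric] d[symmetric] by (simp add: algebra_simps)
  qed
  then show ?case by blast
qed

text \<open>Newton interpolation: each new node is fitted by adding a multiple of the product that
  vanishes at all earlier nodes, which leaves the earlier values unchanged.\<close>

lemma gram_expansion:
  "\<exists>e. \<forall>k\<in>{1..M}. f k = (\<Sum>n<M. e n * gram N n (centred N k))"
proof (induction M)
  case 0
  show ?case by simp
next
  case (Suc M)
  then obtain e where e: "\<And>k. k \<in> {1..M} \<Longrightarrow> f k = (\<Sum>n<M. e n * gram N n (centred N k))"
    by blast
  obtain d where d:
    "\<And>u. (\<Prod>j=1..M. u - centred N j) = (\<Sum>n<Suc M. d n * gram N n u)"
    using prod_gram_combination[where M = M and c = "centred N" and N = N] by blast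
  define p where "p = (\<lambda>u. \<Prod>j=1..M. u - centred N j)"
  define q where "q = (f (Suc M) - (\<Sum>n<M. e n * gram N n (centred N (Suc M))))
      / p (centred N (Suc M))"
  define e' where "e' = (\<lambda>n. (if n < M then e n else 0) + q * d n)"
  have p0: "p (centred N k) = 0" if "k \<in> {1..M}" for k
    using that by (auto simp: p_def)
  have p1: "p (centred N (Suc M)) \<noteq> 0"
    by (auto simp: p_def centred_def)
  have eq: "(\<Sum>n<Suc M. e' n * gram N n u) = (\<Sum>n<M. e n * gram N n u) + q * p u" for u
    unfolding p_def d e'_def by (simp add: algebra_simps sum.distrib sum_distrib_left)
  have "f k = (\<Sum>n<Suc M. e' n * gram N n (centred N k))" if "k \<in> {1..Suc M}" for k
    using that e[of k] p0[of k] p1 unfolding eq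
    by (cases "k = Suc M") (auto simp: q_def)
  then show ?case by blast
qed

lemma gram_inner_0: "gram_inner N 0 0 = real N"
  by (simp add: gram_inner_def)

lemma sum_centred: "(\<Sum>k=1..N. centred N k) = 0"
  using sum_gram_eq_0[of 1 N] by simp

text \<open>This is the squared norm of \<open>gram N 1\<close>, obtained from the norm
  recursion.\<close>

lemma sum_centred_squares: "(\<Sum>k=1..N. (centred N k)\<^sup>2) = real N * (real N ^ 2 - 1) / 3"
  using gram_inner_Suc_Suc[of N 0]
  by (simp add: gram_inner_0 gram_inner_def gram_coeff_def power2_eq_square)

subsection \<open>The Cauchy-Schwarz bound\<close>

text \<open>The correlation bound would already follow with \<open>4/3 + 2/(3 N^2)\<close> in place
  of \<open>4/3\<close>; the difference is the margin that settles the equality case.\<close>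

lemma weighted_square_sum_bound:
  fixes z :: "nat \<Rightarrow> real"
  assumes N: "N \<ge> 2" and z0: "(\<Sum>k=1..N. z k) = 0"
  defines "W \<equiv> (\<Sum>k=1..N. centred N k * z k)\<^sup>2 / (\<Sum>k=1..N. (centred N k)\<^sup>2)"
  defines "R \<equiv> (\<Sum>k=1..N. (z k)\<^sup>2) - W"
  shows "(\<Sum>k=1..N. centred N k * (z k)\<^sup>2)\<^sup>2 \<le> real N ^ 2 * (4 / 3 * W * R + R\<^sup>2)"
proof -
  define u where "u = centred N"
  define h where "h = (\<lambda>n. gram_inner N n n)"
  obtain e where e: "\<And>k. k \<in> {1..N} \<Longrightarrow> z k = (\<Sum>n<N. e n * gram N n (u k))"
    using gram_expansion[of N z N] unfolding u_def by blast
  define E where "E = (\<lambda>j. \<Sum>k=1..N. gram N j (u k) * z k)"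
  have E_sum: "E j = (\<Sum>n<N. e n * gram_inner N j n)" for j
  proof -
    have "E j = (\<Sum>k=1..N. \<Sum>n<N. e n * (gram N j (u k) * gram N n (u k)))"
      unfolding E_def by (intro sum.cong) (auto simp: e sum_distrib_left algebra_simps)
    also have "\<dots> = (\<Sum>n<N. e n * gram_inner N j n)"
      unfolding gram_inner_def u_def by (subst sum.swap) (simp add: sum_distrib_left)
    finally show ?thesis .
  qed
  have E_less: "E j = e j * h j" if "j < N" for j
  proof -
    have "E j = (\<Sum>n<N. if n = j then e j * h j else 0)"
      unfolding E_sum h_def by (intro sum.cong) (auto simp: gram_inner_neq)
    then show ?thesis using that by simp
  qed
  \<comment> \<open>Degree \<open>N\<close> is orthogonal to all lower degrees, so multiplication by
    \<open>u\<close> produces no term beyond the last coefficient of \<open>z\<close>.\<close>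
  have E_N: "E N = 0"
    unfolding E_sum by (intro sum.neutral) (auto simp: gram_inner_neq)
  have expand: "(\<Sum>k=1..N. f k * z k) = (\<Sum>n<N. e n * (\<Sum>k=1..N. f k * gram N n (u k)))" for f
  proof -
    have "(\<Sum>k=1..N. f k * z k) = (\<Sum>k=1..N. \<Sum>n<N. e n * (f k * gram N n (u k)))"
      by (intro sum.cong) (auto simp: e sum_distrib_left algebra_simps)
    also have "\<dots> = (\<Sum>n<N. e n * (\<Sum>k=1..N. f k * gram N n (u k)))"
      by (subst sum.swap) (simp add: sum_distrib_left)
    finally show ?thesis .
  qed
  have hpos: "h n > 0" if "n < N" for n
    using gram_inner_pos[OF that] by (simp add: h_def)
  have hSuc: "h (Suc n) = gram_coeff N (Suc n) * h n" for n
    by (simp add: h_def gram_inner_Suc_Suc)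
  define w where "w = (\<lambda>n. (e n)\<^sup>2 * h n)"
  have w_nonneg: "w n \<ge> 0" if "n < N" for n
    using hpos[OF that] by (simp add: w_def)
  have e0: "e 0 = 0"
    using E_less[of 0] N z0 hpos[of 0] by (simp add: E_def)
  have lessThan_N: "{..<N} = insert 0 (insert 1 {2..<N})" using N by auto
  \<comment> \<open>\<open>gram N 1\<close> is \<open>u\<close> itself, so \<open>W\<close> is the
    squared norm of the projection of \<open>z\<close> onto \<open>u\<close>.\<close>
  have W: "W = w 1"
    using E_less[of 1] N hpos[of 1]
    by (simp add: W_def w_def E_def h_def gram_inner_def u_def power2_eq_square)
  have S: "(\<Sum>k=1..N. (z k)\<^sup>2) = (\<Sum>n<N. w n)"
  proof -
    have "(\<Sum>k=1..N. (z k)\<^sup>2) = (\<Sum>n<N. e n * E n)"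
      using expand[of z] by (simp add: E_def power2_eq_square mult.commute)
    then show ?thesis
      by (simp add: E_less w_def power2_eq_square mult.assoc)
  qed
  have R: "R = (\<Sum>n=2..<N. w n)"
    unfolding R_def S W lessThan_N by (simp add: w_def e0)
  define T where "T = (\<Sum>k=1..N. u k * (z k)\<^sup>2)"
  \<comment> \<open>The two off-diagonals of multiplication by \<open>u\<close> contribute equally,
    whence the factor 2. The sum starts at 1 because \<open>e 0 = 0\<close>.\<close>
  have T: "T = 2 * (\<Sum>n=1..<N-1. e n * e (Suc n) * h (Suc n))"
  proof -
    obtain L where L: "N = Suc L" "L \<ge> 1" using N by (cases N) auto
    have "T = (\<Sum>k=1..N. (u k * z k) * z k)"
      by (simp add: T_def power2_eq_square mult.assoc)
    also have "\<dots> = (\<Sum>n<N. e n * (\<Sum>k=1..N. (u k * gram N n (u k)) * z k))"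
      using expand[of "\<lambda>k. u k * z k"] by (simp add: algebra_simps)
    also have "\<dots> = (\<Sum>n<N. e n * (E (Suc n) + gram_coeff N n * E (n - 1)))"
      unfolding gram_times E_def
      by (simp add: algebra_simps sum.distrib sum_distrib_left del: gram.simps)
    also have "\<dots> = (\<Sum>n<N. e n * E (Suc n)) + (\<Sum>n<N. e n * (gram_coeff N n * E (n - 1)))"
      by (simp add: distrib_left sum.distrib)
    also have "(\<Sum>n<N. e n * E (Suc n)) = (\<Sum>n<L. e n * E (Suc n))"
      using E_N by (simp add: L)
    also have "\<dots> = (\<Sum>n<L. e n * e (Suc n) * h (Suc n))"
      by (intro sum.cong) (auto simp: E_less L)
    also have "(\<Sum>n<N. e n * (gram_coeff N n * E (n - 1)))
        = (\<Sum>n<L. e (Suc n) * (gram_coeff N (Suc n) * E n))"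
      unfolding L sum.lessThan_Suc_shift by simp
    also have "\<dots> = (\<Sum>n<L. e n * e (Suc n) * h (Suc n))"
      by (intro sum.cong) (auto simp: E_less L hSuc)
    also have "(\<Sum>n<L. e n * e (Suc n) * h (Suc n)) = (\<Sum>n=1..<L. e n * e (Suc n) * h (Suc n))"
      using L(2) by (intro sum.mono_neutral_right) (auto simp: e0 not_less_eq_eq Suc_le_eq)
    finally show ?thesis by (simp add: L)
  qed
  \<comment> \<open>The splitting \<open>b\<^sub>n = \<kappa>\<^sub>n\<^sub>-\<^sub>1 (1 - \<kappa>\<^sub>n)\<close> of the limits \<open>b\<^sub>n = n\<^sup>2 / (4 n\<^sup>2 - 1)\<close> of
    \<open>gram_coeff N n / N\<^sup>2\<close> makes the two neighbours of each coefficient contribute total weight 1.\<close>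
  define \<kappa> where "\<kappa> = (\<lambda>n. (real n + 1) / (2 * real n + 1))"
  have \<kappa>pos: "\<kappa> n > 0" for n by (simp add: \<kappa>_def add_pos_nonneg)
  define a where "a = (\<lambda>n. sqrt (\<kappa> n * h n) * e n)"
  define b where "b = (\<lambda>n. e (Suc n) * h (Suc n) / sqrt (\<kappa> n * h n))"
  define R' where "R' = (\<Sum>n=2..<N. \<kappa> n * w n)"
  have ab: "a n * b n = e n * e (Suc n) * h (Suc n)" if "n < N" for n
    using hpos[OF that] \<kappa>pos[of n] by (simp add: a_def b_def)
  have "(\<Sum>n=1..<N-1. (a n)\<^sup>2) = (\<Sum>n=1..<N-1. \<kappa> n * w n)"
  proof (intro sum.cong refl)
    fix n assume "n \<in> {1..<N-1}"
    then have "h n > 0" by (intro hpos) auto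
    then show "(a n)\<^sup>2 = \<kappa> n * w n"
      using \<kappa>pos[of n] by (simp add: a_def w_def power_mult_distrib)
  qed
  also have "\<dots> \<le> (\<Sum>n=1..<N. \<kappa> n * w n)"
    using w_nonneg \<kappa>pos by (intro sum_mono2) (auto intro!: mult_nonneg_nonneg less_imp_le[OF \<kappa>pos])
  also have "\<dots> = 2 / 3 * w 1 + R'"
    using N by (simp add: sum.atLeast_Suc_lessThan R'_def \<kappa>_def numeral_2_eq_2)
  finally have a_le: "(\<Sum>n=1..<N-1. (a n)\<^sup>2) \<le> 2 / 3 * w 1 + R'" .
  have "(\<Sum>n=1..<N-1. (b n)\<^sup>2) \<le> (\<Sum>n=1..<N-1. real N ^ 2 * ((1 - \<kappa> (Suc n)) * w (Suc n)))"
  proof (intro sum_mono)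
    fix n assume n: "n \<in> {1..<N-1}"
    then have h: "h n > 0" by (intro hpos) auto
    have wn: "w (Suc n) \<ge> 0" using n by (intro w_nonneg) auto
    have "(b n)\<^sup>2 = w (Suc n) * (gram_coeff N (Suc n) / \<kappa> n)"
      using h \<kappa>pos[of n]
      by (simp add: b_def w_def power_divide power_mult_distrib hSuc power2_eq_square field_simps)
    also have "gram_coeff N (Suc n) / \<kappa> n
        = (real N ^ 2 - real (Suc n) ^ 2) * (1 - \<kappa> (Suc n))"
    proof -
      have eq: "4 * real (Suc n) ^ 2 - 1 = (2 * real n + 1) * (2 * real n + 3)"
        by (simp add: power2_eq_square algebra_simps)
      have nz: "2 * real n + 1 \<noteq> 0" "2 * real n + 3 \<noteq> 0" "real n + 1 \<noteq> 0"
        by (auto simp: add_nonneg_eq_0_iff)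
      have cancel: "r\<^sup>2 * K / (p * q) / (r / p) = K * (r / q)"
        if "p \<noteq> 0" "q \<noteq> 0" "r \<noteq> 0" for K p q r :: real
        using that by (simp add: field_simps power2_eq_square)
      have k: "1 - \<kappa> (Suc n) = (real n + 1) / (2 * real n + 3)"
        using nz by (simp add: \<kappa>_def field_simps)
      show ?thesis
        unfolding gram_coeff_def eq k using cancel[OF nz] by (simp add: \<kappa>_def add.commute)
    qed
    \<comment> \<open>Dropping \<open>(n + 1)^2\<close> replaces the coefficient by its limit form,
      for which the weights balance.\<close>
    also have "w (Suc n) * \<dots> \<le> w (Suc n) * (real N ^ 2 * (1 - \<kappa> (Suc n)))"
      using wn by (intro mult_left_mono mult_right_mono) (auto simp: \<kappa>_def)
    finally show "(b n)\<^sup>2 \<le> real N ^ 2 * ((1 - \<kappa> (Suc n)) * w (Suc n))"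
      by (simp add: mult_ac)
  qed
  also have "\<dots> = real N ^ 2 * (\<Sum>n=2..<N. (1 - \<kappa> n) * w n)"
  proof -
    have "{2..<N} = {Suc 1..<Suc (N - 1)}" using N by auto
    then show ?thesis by (simp only: sum.shift_bounds_Suc_ivl sum_distrib_left)
  qed
  also have "\<dots> = real N ^ 2 * (R - R')"
    by (simp add: R R'_def algebra_simps sum_subtractf)
  finally have b_le: "(\<Sum>n=1..<N-1. (b n)\<^sup>2) \<le> real N ^ 2 * (R - R')" .
  have R'_le: "R' \<le> R" unfolding R R'_def
    using w_nonneg by (intro sum_mono mult_left_le_one_le) (auto simp: \<kappa>_def)
  \<comment> \<open>Every \<kappa> weight exceeds 1/2.\<close>
  have R'_ge: "R / 2 \<le> R'" unfolding R R'_def sum_divide_distrib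
  proof (intro sum_mono)
    fix n assume "n \<in> {2..<N}"
    then have "w n * (1 / 2) \<le> w n * \<kappa> n"
      using w_nonneg by (intro mult_left_mono) (auto simp: \<kappa>_def field_simps)
    then show "w n / 2 \<le> \<kappa> n * w n" by (simp add: mult.commute)
  qed
  have R_nonneg: "R \<ge> 0" unfolding R using w_nonneg by (intro sum_nonneg) auto
  have w1: "w 1 \<ge> 0" using N by (intro w_nonneg) auto
  have "T = 2 * (\<Sum>n=1..<N-1. a n * b n)"
    unfolding T by (intro arg_cong[where f = "(*) 2"] sum.cong) (auto simp: ab)
  then have "T\<^sup>2 = 4 * (\<Sum>n=1..<N-1. a n * b n)\<^sup>2"
    by (simp add: power2_eq_square)
  also have "\<dots> \<le> 4 * ((\<Sum>n=1..<N-1. (a n)\<^sup>2) * (\<Sum>n=1..<N-1. (b n)\<^sup>2))"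
    by (intro mult_left_mono Cauchy_Schwarz_ineq_sum) auto
  also have "\<dots> \<le> 4 * ((2 / 3 * w 1 + R') * (real N ^ 2 * (R - R')))"
    using w1 R'_ge R_nonneg
    by (intro mult_left_mono mult_mono a_le b_le) (auto intro: sum_nonneg)
  \<comment> \<open>Here \<open>4 R' (R - R')\<close> is completed to a difference of squares.
    Dropping the subtracted square and using \<open>R - R' \<le> R / 2\<close> yields the constant
    4/3.\<close>
  also have "\<dots> = real N ^ 2 * (8 / 3 * w 1 * (R - R') + (R\<^sup>2 - (R - 2 * R')\<^sup>2))"
    by (simp add: power2_eq_square field_simps)
  also have "\<dots> \<le> real N ^ 2 * (8 / 3 * w 1 * (R / 2) + R\<^sup>2)"
    using w1 R'_ge by (intro mult_left_mono add_mono) auto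
  finally show ?thesis
    by (simp add: T_def u_def W mult_ac)
qed

subsection \<open>Minimum and maximum of a uniform pair\<close>

text \<open>The prescribed point masses add up to 1, so each variable almost surely takes a listed
  value. The expectation becomes a finite sum over pairs of distinct values, and grouping equal
  indices (\<open>csum\<close>) turns multiplicities into sums over indices, so ties need no special
  treatment.\<close>

lemma expectation_uniform_pair:
  fixes \<phi> :: "real \<Rightarrow> real \<Rightarrow> real" and x :: "nat \<Rightarrow> real"
  assumes "prob_space M" and indep: "prob_space.indep_var M borel X1 borel X2"
    and U1: "uniform_on_family M X1 N x" and U2: "uniform_on_family M X2 N x"
    and N: "N > 0"
    and meas: "(\<lambda>\<omega>. \<phi> (X1 \<omega>) (X2 \<omega>)) \<in> borel_measurable M"
  shows "prob_space.expectation M (\<lambda>\<omega>. \<phi> (X1 \<omega>) (X2 \<omega>))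
           = (\<Sum>i=1..N. \<Sum>j=1..N. \<phi> (x i) (x j)) / real N ^ 2"
proof -
  interpret prob_space M by fact
  define I where "I = {1..N}"
  define Y where "Y = x ` I"
  have fin: "finite Y" "finite I" by (auto simp: Y_def I_def)
  define c where "c = (\<lambda>y. real (card {i \<in> I. x i = y}))"
  have csum: "(\<Sum>y\<in>Y. c y * f y) = (\<Sum>i\<in>I. f (x i))" for f :: "real \<Rightarrow> real"
  proof -
    have "(\<Sum>i\<in>I. f (x i)) = (\<Sum>y\<in>Y. \<Sum>i\<in>{i \<in> I. x i = y}. f (x i))"
      unfolding Y_def by (rule sum.image_gen) (rule fin)
    also have "\<dots> = (\<Sum>y\<in>Y. c y * f y)"
      by (intro sum.cong) (auto simp: c_def)
    finally show ?thesis by simp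
  qed
  have level: "X \<in> borel_measurable M" "\<And>y. y \<in> Y \<Longrightarrow> prob {\<omega> \<in> space M. X \<omega> = y} = c y / real N"
    if "uniform_on_family M X N x" for X
    using that by (auto simp: uniform_on_family_def Y_def I_def c_def)
  have [measurable]: "X1 \<in> borel_measurable M" "X2 \<in> borel_measurable M"
    using level(1) U1 U2 by auto
  have AE: "AE \<omega> in M. X \<omega> \<in> Y" if U: "uniform_on_family M X N x" for X
  proof -
    note [measurable] = level(1)[OF U]
    have "prob (\<Union>y\<in>Y. {\<omega> \<in> space M. X \<omega> = y}) = (\<Sum>y\<in>Y. prob {\<omega> \<in> space M. X \<omega> = y})"
      by (rule finite_measure_finite_Union) (auto simp: fin disjoint_family_on_def)
    also have "\<dots> = (\<Sum>y\<in>Y. c y * (1 / real N))"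
      using level(2)[OF U] by (intro sum.cong) auto
    also have "\<dots> = 1"
      unfolding csum using N by (simp add: I_def)
    finally have "AE \<omega> in M. \<omega> \<in> (\<Union>y\<in>Y. {\<omega> \<in> space M. X \<omega> = y})"
      by (rule AE_prob_1)
    then show ?thesis by eventually_elim auto
  qed
  define A where "A = (\<lambda>y y'. {\<omega> \<in> space M. X1 \<omega> = y \<and> X2 \<omega> = y'})"
  have A_sets [measurable]: "A y y' \<in> sets M" for y y' by (simp add: A_def)
  have A_prob: "prob (A y y') = c y / real N * (c y' / real N)" if "y \<in> Y" "y' \<in> Y" for y y'
  proof -
    have "prob (A y y') = prob ((\<lambda>\<omega>. (X1 \<omega>, X2 \<omega>)) -` ({y} \<times> {y'}) \<inter> space M)"
      by (intro arg_cong[where f = prob]) (auto simp: A_def)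
    also have "\<dots> = prob (X1 -` {y} \<inter> space M) * prob (X2 -` {y'} \<inter> space M)"
      by (rule indep_varD[OF indep]) auto
    also have "X1 -` {y} \<inter> space M = {\<omega> \<in> space M. X1 \<omega> = y}" by auto
    also have "X2 -` {y'} \<inter> space M = {\<omega> \<in> space M. X2 \<omega> = y'}" by auto
    finally show ?thesis using level(2) U1 U2 that by simp
  qed
  have "expectation (\<lambda>\<omega>. \<phi> (X1 \<omega>) (X2 \<omega>))
      = expectation (\<lambda>\<omega>. \<Sum>y\<in>Y. \<Sum>y'\<in>Y. \<phi> y y' * indicator (A y y') \<omega>)"
  proof (rule integral_cong_AE)
    show "AE \<omega> in M. \<phi> (X1 \<omega>) (X2 \<omega>) = (\<Sum>y\<in>Y. \<Sum>y'\<in>Y. \<phi> y y' * indicator (A y y') \<omega>)"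
      using AE[OF U1] AE[OF U2] AE_space
    proof eventually_elim
      case (elim \<omega>)
      have "(\<Sum>y\<in>Y. \<Sum>y'\<in>Y. \<phi> y y' * indicator (A y y') \<omega>)
          = (\<Sum>y\<in>Y. \<Sum>y'\<in>Y. if y' = X2 \<omega> then if y = X1 \<omega> then \<phi> y y' else 0 else 0)"
        using elim by (intro sum.cong) (auto simp: A_def indicator_def)
      also have "\<dots> = \<phi> (X1 \<omega>) (X2 \<omega>)"
        using elim fin by simp
      finally show ?case by simp
    qed
  qed (use meas in auto)
  also have "\<dots> = (\<Sum>y\<in>Y. \<Sum>y'\<in>Y. \<phi> y y' * prob (A y y'))"
  proof -
    have "integrable M (\<lambda>\<omega>. \<phi> y y' * indicator (A y y') \<omega>)" for y y'
      by (intro integrable_mult_right integrable_real_indicator) (auto simp: emeasure_eq_measure)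
    then show ?thesis
      by (subst Bochner_Integration.integral_sum, (simp add: Bochner_Integration.integrable_sum; fail))+
        (simp add: Bochner_Integration.integral_sum)
  qed
  also have "\<dots> = (\<Sum>y\<in>Y. c y * (\<Sum>y'\<in>Y. c y' * (\<phi> y y' / real N ^ 2)))"
    by (simp add: A_prob sum_distrib_left power2_eq_square mult_ac)
  also have "\<dots> = (\<Sum>i\<in>I. \<Sum>j\<in>I. \<phi> (x i) (x j) / real N ^ 2)"
    unfolding csum ..
  finally show ?thesis
    by (simp add: I_def sum_divide_distrib)
qed

text \<open>Appending a largest value adds \<open>2 n + 1\<close> ordered pairs, all with that value
  as maximum.\<close>

lemma sum_max_pairs:
  fixes x :: "nat \<Rightarrow> real" and F :: "real \<Rightarrow> real"
  assumes "mono_on {1..n} x"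
  shows "(\<Sum>i=1..n. \<Sum>j=1..n. F (max (x i) (x j))) = (\<Sum>k=1..n. (2 * real k - 1) * F (x k))"
  using assms
proof (induction n)
  case 0
  show ?case by simp
next
  case (Suc n)
  have m: "max (x i) (x (Suc n)) = x (Suc n)" "max (x (Suc n)) (x i) = x (Suc n)" if "i \<in> {1..n}" for i
    using that mono_onD[OF Suc.prems, of i "Suc n"] by auto
  have IH: "(\<Sum>i=1..n. \<Sum>j=1..n. F (max (x i) (x j))) = (\<Sum>k=1..n. (2 * real k - 1) * F (x k))"
    by (intro Suc.IH mono_on_subset[OF Suc.prems]) auto
  have "(\<Sum>i=1..Suc n. \<Sum>j=1..Suc n. F (max (x i) (x j)))
      = (\<Sum>i=1..n. \<Sum>j=1..n. F (max (x i) (x j))) + (\<Sum>i=1..n. F (max (x i) (x (Suc n))))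
        + (\<Sum>j=1..n. F (max (x (Suc n)) (x j))) + F (x (Suc n))"
    by (simp add: sum.distrib)
  also have "(\<Sum>i=1..n. F (max (x i) (x (Suc n)))) = real n * F (x (Suc n))"
    by (simp add: m)
  also have "(\<Sum>j=1..n. F (max (x (Suc n)) (x j))) = real n * F (x (Suc n))"
    by (simp add: m)
  finally show ?case
    unfolding IH by (simp add: algebra_simps)
qed

text \<open>Minimum and maximum together are just the two entries of the pair, so this reduces to
  \<open>sum_max_pairs\<close>.\<close>

lemma sum_min_pairs:
  fixes x :: "nat \<Rightarrow> real" and F :: "real \<Rightarrow> real"
  assumes "mono_on {1..n} x"
  shows "(\<Sum>i=1..n. \<Sum>j=1..n. F (min (x i) (x j)))
           = (\<Sum>k=1..n. (2 * real n - 2 * real k + 1) * F (x k))"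
proof -
  have "F (min a b) = F a + F b - F (max a b)" for a b
    by (auto simp: min_def max_def)
  then have "(\<Sum>i=1..n. \<Sum>j=1..n. F (min (x i) (x j)))
      = 2 * real n * (\<Sum>k=1..n. F (x k)) - (\<Sum>i=1..n. \<Sum>j=1..n. F (max (x i) (x j)))"
    by (simp add: sum.distrib sum_subtractf sum_distrib_left[symmetric])
  also have "\<dots> = 2 * real n * (\<Sum>k=1..n. F (x k)) - (\<Sum>k=1..n. (2 * real k - 1) * F (x k))"
    by (simp only: sum_max_pairs[OF assms])
  also have "\<dots> = (\<Sum>k=1..n. (2 * real n - 2 * real k + 1) * F (x k))"
    by (simp add: sum_distrib_left sum_subtractf[symmetric] algebra_simps)
  finally show ?thesis .
qed

text \<open>The means are \<open>m - a\<close> and \<open>m + a\<close>. Since minimum times maximum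
  equals \<open>X1 * X2\<close>, whose mean is \<open>m^2\<close>, the covariance is
  \<open>m^2 - (m - a) (m + a) = a^2\<close>.\<close>

lemma moments_min_max_uniform_pair:
  fixes x :: "nat \<Rightarrow> real"
  assumes M: "prob_space M" and indep: "prob_space.indep_var M borel X1 borel X2"
    and U1: "uniform_on_family M X1 N x" and U2: "uniform_on_family M X2 N x"
    and N: "N > 0" and mono: "mono_on {1..N} x"
  defines "L \<equiv> \<lambda>\<omega>. min (X1 \<omega>) (X2 \<omega>)" and "H \<equiv> \<lambda>\<omega>. max (X1 \<omega>) (X2 \<omega>)"
  defines "z \<equiv> \<lambda>k. x k - (\<Sum>i=1..N. x i) / real N"
  defines "a \<equiv> (\<Sum>k=1..N. centred N k * z k) / real N ^ 2"
    and "S \<equiv> (\<Sum>k=1..N. (z k)\<^sup>2)" and "T \<equiv> (\<Sum>k=1..N. centred N k * (z k)\<^sup>2)"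
  shows "covariance M L H = a\<^sup>2"
    and "prob_space.variance M L = S / real N - a\<^sup>2 - T / real N ^ 2"
    and "prob_space.variance M H = S / real N - a\<^sup>2 + T / real N ^ 2"
proof -
  interpret prob_space M by fact
  define m where "m = (\<Sum>i=1..N. x i) / real N"
  have xsum: "(\<Sum>k=1..N. x k) = real N * m" using N by (simp add: m_def)
  have z: "x k = z k + m" for k by (simp add: z_def m_def)
  have z0: "(\<Sum>k=1..N. z k) = 0"
    using N by (simp add: z_def sum_subtractf)
  have A: "(\<Sum>k=1..N. centred N k * z k) = real N ^ 2 * a"
    using N by (simp add: a_def)
  have wH: "2 * real k - 1 = centred N k + real N" for k by (simp add: centred_def)
  have wL: "2 * real N - 2 * real k + 1 = real N - centred N k" for k by (simp add: centred_def)
  have [measurable]: "X1 \<in> borel_measurable M" "X2 \<in> borel_measurable M"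
    using U1 U2 by (auto simp: uniform_on_family_def)
  note pair = expectation_uniform_pair[OF M indep U1 U2 N]
  have EH: "expectation (\<lambda>\<omega>. F (H \<omega>)) = (\<Sum>k=1..N. (centred N k + real N) * F (x k)) / real N ^ 2"
    if [measurable]: "F \<in> borel_measurable borel" for F
    unfolding H_def wH[symmetric] sum_max_pairs[OF mono, where F = F, symmetric]
    by (rule pair[of "\<lambda>a b. F (max a b)"]) measurable
  have EL: "expectation (\<lambda>\<omega>. F (L \<omega>)) = (\<Sum>k=1..N. (real N - centred N k) * F (x k)) / real N ^ 2"
    if [measurable]: "F \<in> borel_measurable borel" for F
    unfolding L_def wL[symmetric] sum_min_pairs[OF mono, where F = F, symmetric]
    by (rule pair[of "\<lambda>a b. F (min a b)"]) measurable
  have "(\<Sum>k=1..N. (centred N k + real N) * x k)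
      = (\<Sum>k=1..N. centred N k * z k) + m * (\<Sum>k=1..N. centred N k)
        + real N * (\<Sum>k=1..N. z k) + real N * (real N * m)"
    by (simp add: z sum.distrib sum_distrib_left algebra_simps)
  also have "\<dots> = real N ^ 2 * (m + a)"
    unfolding A sum_centred z0 by (simp add: algebra_simps power2_eq_square)
  finally have mH: "expectation H = m + a"
    using EH[of "\<lambda>x. x"] N by simp
  have "(\<Sum>k=1..N. (real N - centred N k) * x k)
      = real N * (\<Sum>k=1..N. z k) + real N * (real N * m)
        - (\<Sum>k=1..N. centred N k * z k) - m * (\<Sum>k=1..N. centred N k)"
    by (simp add: z sum.distrib sum_subtractf sum_distrib_left algebra_simps)
  also have "\<dots> = real N ^ 2 * (m - a)"
    unfolding A sum_centred z0 by (simp add: algebra_simps power2_eq_square)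
  finally have mL: "expectation L = m - a"
    using EL[of "\<lambda>x. x"] N by simp
  have "(\<Sum>k=1..N. (centred N k + real N) * (x k - (m + a))\<^sup>2)
      = T - 2 * a * (\<Sum>k=1..N. centred N k * z k) + a\<^sup>2 * (\<Sum>k=1..N. centred N k)
        + real N * S - 2 * a * real N * (\<Sum>k=1..N. z k) + real N * (real N * a\<^sup>2)"
    by (simp add: z S_def T_def sum.distrib sum_subtractf sum_distrib_left power2_eq_square algebra_simps)
  also have "\<dots> = real N ^ 2 * (S / real N - a\<^sup>2 + T / real N ^ 2)"
    unfolding A sum_centred z0 using N by (simp add: field_simps power2_eq_square)
  finally show "variance H = S / real N - a\<^sup>2 + T / real N ^ 2"
    using EH[of "\<lambda>t. (t - (m + a))\<^sup>2"] N unfolding mH by simp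
  have "(\<Sum>k=1..N. (real N - centred N k) * (x k - (m - a))\<^sup>2)
      = real N * S + 2 * a * real N * (\<Sum>k=1..N. z k) + real N * (real N * a\<^sup>2)
       - T - 2 * a * (\<Sum>k=1..N. centred N k * z k) - a\<^sup>2 * (\<Sum>k=1..N. centred N k)"
    by (simp add: z S_def T_def sum.distrib sum_subtractf sum_distrib_left power2_eq_square algebra_simps)
  also have "\<dots> = real N ^ 2 * (S / real N - a\<^sup>2 - T / real N ^ 2)"
    unfolding A sum_centred z0 using N by (simp add: field_simps power2_eq_square)
  finally show "variance L = S / real N - a\<^sup>2 - T / real N ^ 2"
    using EL[of "\<lambda>t. (t - (m - a))\<^sup>2"] N unfolding mL by simp
  have max_sum: "(\<Sum>i=1..N. \<Sum>j=1..N. max (x i) (x j)) = real N ^ 2 * (m + a)"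
    using pair[of max] mH N by (simp add: H_def divide_eq_eq mult.commute)
  have min_sum: "(\<Sum>i=1..N. \<Sum>j=1..N. min (x i) (x j)) = real N ^ 2 * (m - a)"
    using pair[of min] mL N by (simp add: L_def divide_eq_eq mult.commute)
  have "(\<Sum>i=1..N. \<Sum>j=1..N. (min (x i) (x j) - (m - a)) * (max (x i) (x j) - (m + a)))
      = (\<Sum>i=1..N. x i) * (\<Sum>j=1..N. x j)
        - (m - a) * (\<Sum>i=1..N. \<Sum>j=1..N. max (x i) (x j))
        - (m + a) * (\<Sum>i=1..N. \<Sum>j=1..N. min (x i) (x j)) + real N ^ 2 * ((m - a) * (m + a))"
  proof -
    have mm: "min s t * max s t = s * t" for s t :: real by (auto simp: min_def max_def)
    have "(min s t - (m - a)) * (max s t - (m + a))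
        = s * t - (m - a) * max s t - (m + a) * min s t + (m - a) * (m + a)" for s t
      unfolding mm[of s t, symmetric] by (simp add: algebra_simps)
    then show ?thesis
      unfolding sum_product
      by (simp add: sum.distrib sum_subtractf sum_distrib_left power2_eq_square)
  qed
  also have "\<dots> = real N ^ 2 * a\<^sup>2"
    unfolding xsum max_sum min_sum by (simp add: algebra_simps power2_eq_square)
  finally show "covariance M L H = a\<^sup>2"
    unfolding covariance_def mL mH
    using pair[of "\<lambda>s t. (min s t - (m - a)) * (max s t - (m + a))"] N
    by (simp add: L_def H_def)
qed

text \<open>Pythagoras for the projection onto \<open>u\<close>. It shows that \<open>R\<close> is
  nonnegative and vanishes only if \<open>z\<close> is a multiple of \<open>u\<close>.\<close>

lemma residual_sum_squares:
  fixes z u :: "'a \<Rightarrow> real"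
  assumes "(\<Sum>k\<in>K. (u k)\<^sup>2) \<noteq> 0"
  defines "q \<equiv> (\<Sum>k\<in>K. u k * z k) / (\<Sum>k\<in>K. (u k)\<^sup>2)"
  shows "(\<Sum>k\<in>K. (z k)\<^sup>2) - (\<Sum>k\<in>K. u k * z k)\<^sup>2 / (\<Sum>k\<in>K. (u k)\<^sup>2)
           = (\<Sum>k\<in>K. (z k - q * u k)\<^sup>2)"
proof -
  have "(\<Sum>k\<in>K. (z k - q * u k)\<^sup>2)
      = (\<Sum>k\<in>K. (z k)\<^sup>2) - 2 * q * (\<Sum>k\<in>K. u k * z k) + q\<^sup>2 * (\<Sum>k\<in>K. (u k)\<^sup>2)"
    by (simp add: sum.distrib sum_subtractf sum_distrib_left power2_eq_square algebra_simps)
  then show ?thesis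
    using assms(1) by (simp add: q_def power2_eq_square)
qed

section \<open>The correlation bound and its equality case\<close>

theorem theorem1p2:
  fixes M :: "'a measure" and X1 X2 :: "'a \<Rightarrow> real"
    and N :: nat and x :: "nat \<Rightarrow> real"
  assumes "prob_space M"
    and "N \<ge> 2"
    and "\<forall>i\<in>{1..N - 1}. x i \<le> x (i + 1)"
    and "x 1 < x N"
    and "prob_space.indep_var M borel X1 borel X2"
    and "uniform_on_family M X1 N x"
    and "uniform_on_family M X2 N x"
  defines "\<rho> \<equiv> correlation M (\<lambda>\<omega>. min (X1 \<omega>) (X2 \<omega>)) (\<lambda>\<omega>. max (X1 \<omega>) (X2 \<omega>))"
  shows "\<rho> \<le> (1 - 1 / real N ^ 2) / (2 + 1 / real N ^ 2) \<and>
    (\<rho> = (1 - 1 / real N ^ 2) / (2 + 1 / real N ^ 2) \<longleftrightarrow>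
      (\<exists>c>0. \<forall>i\<in>{1..N - 1}. x (i + 1) - x i = c))"
proof -
  have N0: "N > 0" and N: "real N \<ge> 2" using assms(2) by auto
  have mono: "mono_on {1..N} x"
  proof (rule mono_onI)
    fix i j assume ij: "i \<in> {1..N}" "j \<in> {1..N}" "i \<le> j"
    from ij(3) show "x i \<le> x j"
    proof (induction rule: dec_induct)
      case (step n)
      then have "n \<in> {1..N - 1}" using ij by auto
      with assms(3) have "x n \<le> x (Suc n)" by auto
      with step.IH show ?case by linarith
    qed simp
  qed
  define u where "u = centred N"
  define m where "m = (\<Sum>i=1..N. x i) / real N"
  define z where "z = (\<lambda>k. x k - m)"
  define A where "A = (\<Sum>k=1..N. u k * z k)"
  define a where "a = A / real N ^ 2"
  define S where "S = (\<Sum>k=1..N. (z k)\<^sup>2)"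
  define T where "T = (\<Sum>k=1..N. u k * (z k)\<^sup>2)"
  define h where "h = (\<Sum>k=1..N. (u k)\<^sup>2)"
  define W where "W = A\<^sup>2 / h"
  define R where "R = S - W"
  \<comment> \<open>The reciprocal of the claimed bound.\<close>
  define C where "C = (2 * real N ^ 2 + 1) / (real N ^ 2 - 1)"
  define VL where "VL = prob_space.variance M (\<lambda>\<omega>. min (X1 \<omega>) (X2 \<omega>))"
  define VH where "VH = prob_space.variance M (\<lambda>\<omega>. max (X1 \<omega>) (X2 \<omega>))"
  have N1: "real N ^ 2 - 1 > 0"
    using power_mono[OF N, of 2] by simp
  have C: "C > 0" "(1 - 1 / real N ^ 2) / (2 + 1 / real N ^ 2) = 1 / C"
  proof -
    show "C > 0" unfolding C_def using N1 by (intro divide_pos_pos add_nonneg_pos) auto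
    have "(1 - 1 / real N ^ 2) / (2 + 1 / real N ^ 2)
        = ((real N ^ 2 - 1) / real N ^ 2) / ((2 * real N ^ 2 + 1) / real N ^ 2)"
      using N0 by (simp add: add_divide_distrib diff_divide_distrib)
    then show "(1 - 1 / real N ^ 2) / (2 + 1 / real N ^ 2) = 1 / C"
      using N0 by (simp add: C_def)
  qed
  have h: "h = real N * (real N ^ 2 - 1) / 3"
    by (simp only: h_def u_def sum_centred_squares)
  have hpos: "h > 0" using N0 N1 by (simp add: h)
  have zsum: "(\<Sum>k=1..N. z k) = 0"
    using N0 by (simp add: z_def m_def sum_subtractf)
  note moments = moments_min_max_uniform_pair[OF assms(1,5-7) N0 mono]
  note defs = a_def A_def S_def T_def z_def m_def u_def
  have VL: "VL = S / real N - a\<^sup>2 - T / real N ^ 2"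
    unfolding VL_def defs by (rule moments(2))
  have VH: "VH = S / real N - a\<^sup>2 + T / real N ^ 2"
    unfolding VH_def defs by (rule moments(3))
  have cov: "covariance M (\<lambda>\<omega>. min (X1 \<omega>) (X2 \<omega>)) (\<lambda>\<omega>. max (X1 \<omega>) (X2 \<omega>)) = a\<^sup>2"
    unfolding defs by (rule moments(1))
  have rho: "\<rho> = a\<^sup>2 / sqrt (VL * VH)"
    unfolding \<rho>_def correlation_def VL_def VH_def cov real_sqrt_mult ..
  have T_le: "T\<^sup>2 \<le> real N ^ 2 * (4 / 3 * W * R + R\<^sup>2)"
    unfolding T_def R_def S_def W_def A_def h_def u_def
    by (rule weighted_square_sum_bound) (use assms(2) zsum in auto)
  have R_eq: "R = (\<Sum>k=1..N. (z k - A / h * u k)\<^sup>2)"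
    using residual_sum_squares[of u "{1..N}" z] hpos by (simp add: R_def S_def W_def A_def h_def)
  have R_nonneg: "R \<ge> 0" unfolding R_eq by (intro sum_nonneg) auto
  have W_nonneg: "W \<ge> 0" using hpos by (simp add: W_def)
  have aW: "a\<^sup>2 = W * (real N ^ 2 - 1) / (3 * real N ^ 3)"
  proof -
    have "A\<^sup>2 = W * h" using hpos by (simp add: W_def)
    then show ?thesis
      unfolding a_def h power_divide using N0 by (simp add: field_simps power2_eq_square power3_eq_cube)
  qed
  have Ca: "C * a\<^sup>2 = W * (2 * real N ^ 2 + 1) / (3 * real N ^ 3)"
    using N1 by (simp add: aW C_def)
  \<comment> \<open>\<open>C * a^2\<close> is the common value of both variances when
    \<open>R = 0\<close>, since then also \<open>T = 0\<close>.\<close>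
  have Sa: "S / real N - a\<^sup>2 = R / real N + C * a\<^sup>2"
  proof -
    have "W / real N - a\<^sup>2 = C * a\<^sup>2"
      unfolding Ca unfolding aW using N0
      by (simp add: field_simps power2_eq_square power3_eq_cube)
    then show ?thesis by (simp add: R_def diff_divide_distrib)
  qed
  have prod: "VL * VH = (C * a\<^sup>2)\<^sup>2 + (R\<^sup>2 / real N ^ 2 + 2 * (C * a\<^sup>2) * R / real N - T\<^sup>2 / real N ^ 4)"
  proof -
    have "VL * VH = (S / real N - a\<^sup>2)\<^sup>2 - (T / real N ^ 2)\<^sup>2"
      unfolding VL VH by (simp add: power2_eq_square algebra_simps)
    then show ?thesis
      unfolding Sa by (simp add: power2_eq_square algebra_simps power4_eq_xxxx)
  qed
  \<comment> \<open>The surplus in \<open>W * R\<close> comes from the \<open>+ 1\<close> in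
    \<open>2 N^2 + 1\<close>, the numerator of \<open>C\<close>.\<close>
  have prod_ge: "VL * VH \<ge> (C * a\<^sup>2)\<^sup>2 + 2 * W * R / (3 * real N ^ 4)"
  proof -
    have "T\<^sup>2 / real N ^ 4 \<le> real N ^ 2 * (4 / 3 * W * R + R\<^sup>2) / real N ^ 4"
      by (intro divide_right_mono T_le) auto
    also have "\<dots> = 4 / 3 * W * R / real N ^ 2 + R\<^sup>2 / real N ^ 2"
      using N0 by (simp add: field_simps power2_eq_square power4_eq_xxxx)
    finally have "T\<^sup>2 / real N ^ 4 \<le> 4 / 3 * W * R / real N ^ 2 + R\<^sup>2 / real N ^ 2" .
    moreover have "2 * (C * a\<^sup>2) * R / real N - 4 / 3 * W * R / real N ^ 2 = 2 * W * R / (3 * real N ^ 4)"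
      unfolding Ca using N0
      by (simp add: field_simps power2_eq_square power3_eq_cube power4_eq_xxxx)
    ultimately show ?thesis unfolding prod by linarith
  qed
  have arith: "A > 0" "R = 0" if "c > 0" "\<forall>i\<in>{1..N - 1}. x (i + 1) - x i = c" for c
  proof -
    have xk: "x k = x 1 + (real k - 1) * c" if "1 \<le> k" "k \<le> N" for k
      using that
    proof (induction rule: dec_induct)
      case (step n)
      then have "n \<in> {1..N - 1}" by auto
      with \<open>\<forall>i\<in>{1..N - 1}. x (i + 1) - x i = c\<close> have "x (Suc n) = x n + c"
        by (metis Suc_eq_plus1 add.commute diff_add_cancel)
      with step show ?case by (simp add: algebra_simps)
    qed simp
    \<comment> \<open>The offset left after matching slopes; it vanishes because \<open>z\<close>
      and \<open>u\<close> both sum to 0.\<close>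
    define d where "d = x 1 - m + (real N - 1) / 2 * c"
    have zd: "z k = c / 2 * u k + d" if "k \<in> {1..N}" for k
      using that xk[of k] by (simp add: z_def u_def centred_def d_def field_simps)
    have "(\<Sum>k=1..N. z k) = (\<Sum>k=1..N. c / 2 * u k + d)"
      by (intro sum.cong) (auto simp: zd)
    also have "\<dots> = c / 2 * (\<Sum>k=1..N. u k) + real N * d"
      by (simp add: sum.distrib sum_distrib_left)
    finally have "d = 0"
      using N0 zsum by (simp add: u_def sum_centred[unfolded One_nat_def])
    then have zu: "z k = c / 2 * u k" if "k \<in> {1..N}" for k
      using zd[OF that] by simp
    have A: "A = c / 2 * h"
      unfolding A_def h_def sum_distrib_left
      by (intro sum.cong) (auto simp: zu power2_eq_square)
    show "A > 0" unfolding A using hpos that(1) by simp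
    show "R = 0"
      unfolding R_eq A using hpos by (intro sum.neutral) (auto simp: zu)
  qed
  have "\<rho> \<le> 1 / C \<and> (\<rho> = 1 / C \<longleftrightarrow> (\<exists>c>0. \<forall>i\<in>{1..N - 1}. x (i + 1) - x i = c))"
  proof (cases "A = 0")
    \<comment> \<open>The correlation is 0 here, strictly below \<open>1 / C\<close>, and equal
      positive spacing would force \<open>A > 0\<close>.\<close>
    case True
    then have "\<rho> = 0" by (simp add: rho a_def)
    moreover have "\<not> (\<exists>c>0. \<forall>i\<in>{1..N - 1}. x (i + 1) - x i = c)"
      using arith(1) True by fastforce
    ultimately show ?thesis using C(1) by simp
  next
    case False
    have a: "a\<^sup>2 > 0" using False N0 by (simp add: a_def)
    have W: "W > 0" using False hpos by (simp add: W_def)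
    have "(C * a\<^sup>2)\<^sup>2 \<le> VL * VH"
      using prod_ge R_nonneg W_nonneg
      by (smt (verit) divide_nonneg_nonneg mult_nonneg_nonneg zero_le_power of_nat_0_le_iff)
    then have sq: "C * a\<^sup>2 \<le> sqrt (VL * VH)" by (rule real_le_rsqrt)
    have Ca0: "C * a\<^sup>2 > 0" using C(1) a by simp
    then have sqrt_pos: "sqrt (VL * VH) > 0" using sq by linarith
    have le: "\<rho> \<le> 1 / C"
      unfolding rho using sq sqrt_pos C(1) by (simp add: field_simps)
    have "\<rho> = 1 / C \<longleftrightarrow> sqrt (VL * VH) = C * a\<^sup>2"
      unfolding rho using sq Ca0 C(1) a by (auto simp: field_simps)
    also have "\<dots> \<longleftrightarrow> VL * VH = (C * a\<^sup>2)\<^sup>2"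
      using Ca0 by (smt (verit) real_sqrt_pow2 real_sqrt_unique real_sqrt_le_0_iff)
    also have "\<dots> \<longleftrightarrow> R = 0"
    proof
      assume "VL * VH = (C * a\<^sup>2)\<^sup>2"
      then have "2 * W * R / (3 * real N ^ 4) \<le> 0" using prod_ge by linarith
      then show "R = 0" using W R_nonneg N0 by (auto simp: divide_le_0_iff mult_le_0_iff)
    next
      assume "R = 0"
      \<comment> \<open>With \<open>R = 0\<close> the bound \<open>T_le\<close> forces
        \<open>T = 0\<close>.\<close>
      then show "VL * VH = (C * a\<^sup>2)\<^sup>2" using T_le unfolding prod by simp
    qed
    also have "\<dots> \<longleftrightarrow> (\<exists>c>0. \<forall>i\<in>{1..N - 1}. x (i + 1) - x i = c)"
    proof
      assume "R = 0"
      then have "\<forall>k\<in>{1..N}. (z k - A / h * u k)\<^sup>2 = 0"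
        unfolding R_eq by (subst (asm) sum_nonneg_eq_0_iff) auto
      then have xu: "x k = A / h * u k + m" if "k \<in> {1..N}" for k
        using that by (auto simp: z_def algebra_simps)
      have u1: "u (Suc i) = u i + 2" for i by (simp add: u_def centred_def)
      have "u N - u 1 > 0" using assms(2) by (simp add: u_def centred_def)
      \<comment> \<open>The strict inequality between the extreme values fixes the sign of the slope
        \<open>A / h\<close>; the spacing is twice the slope because the nodes are 2 apart.\<close>
      moreover have "A / h * (u N - u 1) > 0"
        using assms(4) xu[of 1] xu[of N] N0 by (simp add: right_diff_distrib)
      ultimately have "A / h > 0" using zero_less_mult_pos2 by blast
      moreover have "x (i + 1) - x i = A / h * 2" if "i \<in> {1..N - 1}" for i
        using that xu[of i] xu[of "Suc i"] by (auto simp: u1 distrib_left add_divide_distrib)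
      ultimately show "\<exists>c>0. \<forall>i\<in>{1..N - 1}. x (i + 1) - x i = c"
        by (intro exI[of _ "A / h * 2"] conjI mult_pos_pos) auto
    qed (use arith(2) in blast)
    finally show ?thesis using le by blast
  qed
  then show ?thesis unfolding C(2) .
qed

end
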